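(* Let $a$, $b$, $c$ be positive integers with $a \le b \le c$, and suppose that either $c = 1$ or $b > 1$. Then there is a finite simple graph $G$ such that $\gamma(G) = a$, $\gamma_\infty(G) = b$ and $\gamma_{\mathrm{aut}}(G) = c$.
   Context: All graphs are finite and simple, $G=(V,E)$. $\gamma(G)$ is the usual domination number. Two dominating sets $S,S'$ of $G$ are adjacent if there are $v\in S$, $v'\in S'$ with $vv'\in E$ and $S'=(S\setminus\{v\})\cup\{v'\}$. A collection $\mathcal{F}$ of subsets of $V$ is an autonomously dominating family if: (1) every member of $\mathcal{F}$ is a dominating set; (2) for each $S\in\mathcal{F}$ and each $v\in V\setminus S$ there is $S'\in\mathcal{F}$ adjacent to $S$ with $v\in S'$; (3) for each $S\in\mathcal{F}$, every dominating set adjacent to $S$ belongs to $\mathcal{F}$. A set is an autonomous dominating set if it belongs to some autonomously dominating family, and $\gamma_{\mathrm{aut}}(G)$ is the least size of an autonomous dominating set. The eternal domination number $\gamma_\infty(G)$ is the least size of a member of a nonempty family of dominating sets satisfying conditions (1) and (2) (equivalently, the minimum number of guards which, with one guard moving along an edge per attack and the mover chosen by a planner, can defend against any infinite sequence of attacks on vertices).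
   Formalization: Adjacency of dominating sets is taken to require the new vertex v' to lie outside S, so guards never merge; if v' may lie in S, the claim fails, e.g. for (a,b,c) = (1,2,2), where condition (3) would force G to be complete. *)

theory Defs
  imports "Graph_Theory.Pair_Digraph"
begin

text \<open>
  Finite simple graphs are the library's \<^locale>\<open>pair_graph\<close>: finite vertex set, and a
  symmetric irreflexive arc relation, an edge \<open>uv\<close> being the two arcs \<open>(u, v)\<close> and \<open>(v, u)\<close>.
\<close>

definition dominating :: "'a pair_pre_digraph \<Rightarrow> 'a set \<Rightarrow> bool" where
  "dominating G S \<longleftrightarrow>
     S \<subseteq> pverts G \<and> (\<forall>v \<in> pverts G - S. \<exists>u \<in> S. (u, v) \<in> parcs G)"

text \<open>
  A guard moves from \<open>v\<close> to an unoccupied neighbour \<open>v'\<close>. Without \<open>v' \<notin> S\<close>, the set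
  \<open>S - {v}\<close> would count as adjacent to \<open>S\<close> whenever \<open>v\<close> has a neighbour in \<open>S\<close> and
  \<open>S - {v}\<close> dominates; the relation would then not be symmetric, guards could vanish, and
  many graphs (the path on three vertices, for instance) would have no autonomous
  dominating set at all.
\<close>

definition adjacent_sets :: "'a pair_pre_digraph \<Rightarrow> 'a set \<Rightarrow> 'a set \<Rightarrow> bool" where
  "adjacent_sets G S S' \<longleftrightarrow>
     dominating G S \<and> dominating G S' \<and>
     (\<exists>v \<in> S. \<exists>v' \<in> S' - S. (v, v') \<in> parcs G \<and> S' = (S - {v}) \<union> {v'})"

definition eternally_dominating_family :: "'a pair_pre_digraph \<Rightarrow> 'a set set \<Rightarrow> bool" where
  "eternally_dominating_family G F \<longleftrightarrow>
     (\<forall>S \<in> F. dominating G S) \<and>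
     (\<forall>S \<in> F. \<forall>v \<in> pverts G - S. \<exists>S' \<in> F. adjacent_sets G S S' \<and> v \<in> S')"

definition autonomously_dominating_family :: "'a pair_pre_digraph \<Rightarrow> 'a set set \<Rightarrow> bool" where
  "autonomously_dominating_family G F \<longleftrightarrow>
     (\<forall>S \<in> F. dominating G S) \<and>
     (\<forall>S \<in> F. \<forall>v \<in> pverts G - S. \<exists>S' \<in> F. adjacent_sets G S S' \<and> v \<in> S') \<and>
     (\<forall>S \<in> F. \<forall>S'. dominating G S' \<and> adjacent_sets G S S' \<longrightarrow> S' \<in> F)"

definition autonomous_dominating :: "'a pair_pre_digraph \<Rightarrow> 'a set \<Rightarrow> bool" where
  "autonomous_dominating G S \<longleftrightarrow> (\<exists>F. autonomously_dominating_family G F \<and> S \<in> F)"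

definition domination_number :: "'a pair_pre_digraph \<Rightarrow> nat" where
  "domination_number G = (LEAST k. \<exists>S. dominating G S \<and> card S = k)"

definition eternal_domination_number :: "'a pair_pre_digraph \<Rightarrow> nat" where
  "eternal_domination_number G =
     (LEAST k. \<exists>F S. eternally_dominating_family G F \<and> S \<in> F \<and> card S = k)"

definition autonomous_domination_number :: "'a pair_pre_digraph \<Rightarrow> nat" where
  "autonomous_domination_number G =
     (LEAST k. \<exists>S. autonomous_dominating G S \<and> card S = k)"

lemma adjacent_sets_sym:
  assumes "pair_graph G" and "adjacent_sets G S S'"
  shows "adjacent_sets G S' S"
proof -
  interpret pair_graph G by fact
  from assms(2) obtain v v' where *: "v \<in> S" "v' \<notin> S" "(v, v') \<in> parcs G"
    "S' = (S - {v}) \<union> {v'}" "dominating G S" "dominating G S'"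
    by (auto simp: adjacent_sets_def)
  have "(v', v) \<in> parcs G"
    using *(3) pair_sym_arcs by (auto simp: symmetric_def sym_def)
  moreover have "v \<in> S - S'" "v' \<in> S'" "S = (S' - {v'}) \<union> {v}"
    using * by auto
  ultimately show ?thesis
    using *(5,6) unfolding adjacent_sets_def by blast
qed

text \<open>The vertex set itself is autonomous, so the minima above are attained.\<close>

lemma autonomous_dominating_pverts: "autonomous_dominating G (pverts G)"
  unfolding autonomous_dominating_def autonomously_dominating_family_def
  by (rule exI[of _ "{pverts G}"]) (auto simp: adjacent_sets_def dominating_def)

end

theory Submission
  imports Defs "HOL-Library.Nat_Bijection" "HOL-Library.Disjoint_Sets"
begin

text \<open>
  An isolated vertex raises all three numbers by one, so it suffices to realize
  \<open>(1, b, c)\<close> with \<open>2 \<le> b \<le> c\<close>, and \<open>(2, 2, c)\<close>.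

  For eternal domination number two, take two cliques \<open>A\<close> and \<open>B\<close> with \<open>card B = c - 1\<close>, where
  the vertices of \<open>A\<close> are the subsets of \<open>B\<close> (omitting \<open>B\<close> itself if no universal vertex is
  wanted) and cross edges are given by membership. A position with guards in both cliques is never
  in danger. But if \<open>2 \<le> k < c\<close>, the guards can be driven onto a partition of \<open>B\<close> into \<open>k\<close>
  blocks; an attack on the empty set then forces a guard to give up its block. With \<open>c\<close> guards in
  \<open>A\<close>, one of them is always redundant.

  For \<open>(1, b, c)\<close> with \<open>b \<ge> 3\<close>, take a hub \<open>u\<close> adjacent to everything, \<open>b - 2\<close> leaves, a clique
  \<open>insert w D\<close>, and a vertex \<open>v\<close> adjacent to \<open>u\<close> and \<open>w\<close> only. While a guard sits at \<open>u\<close> and one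
  leaf is vacant, all guards outside the leaves may wander freely; if they fit into \<open>D\<close>, an attack
  on the vacant leaf draws the hub guard away and leaves \<open>v\<close> undominated.
\<close>

section \<open>Domination, eternal domination and autonomous domination\<close>

lemma card_swap:
  assumes "finite S" and "x \<in> S" and "y \<notin> S"
  shows "card (insert y (S - {x})) = card S"
  using assms card_Suc_Diff1[of S x] by simp

lemma dominating_finite:
  assumes "pair_graph G" and "dominating G S"
  shows "finite S"
proof -
  interpret pair_graph G by fact
  show ?thesis
    using assms(2) pair_finite_verts by (auto simp: dominating_def intro: finite_subset)
qed

lemma adjacent_setsI:
  assumes "dominating G S" and "dominating G (insert y (S - {x}))"
    and "x \<in> S" and "y \<notin> S" and "(x, y) \<in> parcs G"
  shows "adjacent_sets G S (insert y (S - {x}))"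
  unfolding adjacent_sets_def using assms by fast

lemma adjacent_setsE:
  assumes "adjacent_sets G S S'"
  obtains x y where "x \<in> S" and "y \<notin> S" and "(x, y) \<in> parcs G"
    and "S' = insert y (S - {x})"
  using assms unfolding adjacent_sets_def by auto

lemma autonomous_imp_eternal:
  "autonomously_dominating_family G F \<Longrightarrow> eternally_dominating_family G F"
  unfolding autonomously_dominating_family_def eternally_dominating_family_def
  by (elim conjE, intro conjI)

lemma eternal_dominating:
  "eternally_dominating_family G F \<Longrightarrow> S \<in> F \<Longrightarrow> dominating G S"
  unfolding eternally_dominating_family_def by (elim conjE, rule bspec)

lemma eternal_response:
  assumes "eternally_dominating_family G F" and "S \<in> F" and "v \<in> pverts G - S"
  obtains x where "x \<in> S" and "(x, v) \<in> parcs G" and "insert v (S - {x}) \<in> F"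
proof -
  obtain S' where S': "S' \<in> F" "adjacent_sets G S S'" "v \<in> S'"
    using assms unfolding eternally_dominating_family_def by blast
  from S'(2) obtain x y where "x \<in> S" "y \<notin> S" "(x, y) \<in> parcs G" "S' = insert y (S - {x})"
    by (rule adjacent_setsE)
  with S' assms(3) that show thesis by auto
qed

lemma eternal_occupy:
  assumes "pair_graph G" and "eternally_dominating_family G F" and "S \<in> F" and "v \<in> pverts G"
  obtains S' where "S' \<in> F" and "v \<in> S'" and "card S' = card S"
proof (cases "v \<in> S")
  case False
  then obtain x where "x \<in> S" "insert v (S - {x}) \<in> F"
    using eternal_response[OF assms(2,3)] assms(4) by blast
  moreover have "finite S"
    using assms dominating_finite eternal_dominating by blast
  ultimately show ?thesis
    using that False card_swap by (metis insertI1)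
qed (use that assms in blast)

text \<open>Closure puts every safe move at the opponent's disposal. The lower bounds exploit this:
  any guard may be driven along any edge as long as the result dominates.\<close>

lemma autonomous_move:
  assumes "autonomously_dominating_family G F" and "S \<in> F"
    and "x \<in> S" and "y \<notin> S" and "(x, y) \<in> parcs G" and "dominating G (insert y (S - {x}))"
  shows "insert y (S - {x}) \<in> F"
  using assms unfolding autonomously_dominating_family_def by (meson adjacent_setsI)

lemma domination_number_eqI:
  assumes "dominating G S" and "card S = k" and "\<And>S. dominating G S \<Longrightarrow> k \<le> card S"
  shows "domination_number G = k"
  unfolding domination_number_def by (rule Least_equality) (use assms in auto)

lemma eternal_domination_number_eqI:
  assumes "eternally_dominating_family G F" and "S \<in> F" and "card S = k"
    and "\<And>F S. eternally_dominating_family G F \<Longrightarrow> S \<in> F \<Longrightarrow> k \<le> card S"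
  shows "eternal_domination_number G = k"
  unfolding eternal_domination_number_def by (rule Least_equality) (use assms in auto)

lemma autonomous_domination_number_eqI:
  assumes "autonomously_dominating_family G F" and "S \<in> F" and "card S = k"
    and "\<And>F S. autonomously_dominating_family G F \<Longrightarrow> S \<in> F \<Longrightarrow> k \<le> card S"
  shows "autonomous_domination_number G = k"
  unfolding autonomous_domination_number_def autonomous_dominating_def
  by (rule Least_equality) (use assms in auto)

text \<open>Attack the vertices of \<open>I\<close> one after another. A guard already on
  \<open>I\<close> has no neighbour in \<open>I\<close>, so it never answers and stays; in the end
  the original number of guards occupies all of \<open>I\<close>.\<close>

lemma eternal_independent_bound:
  assumes G: "pair_graph G" and F: "eternally_dominating_family G F" and S: "S \<in> F"
    and I: "I \<subseteq> pverts G" "\<And>x y. x \<in> I \<Longrightarrow> y \<in> I \<Longrightarrow> (x, y) \<notin> parcs G"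
  shows "card I \<le> card S"
proof -
  have "finite I"
    using dominating_finite[OF G, of "pverts G"]
    by (intro finite_subset[OF I(1)]) (simp add: dominating_def)
  then have "I \<subseteq> pverts G \<Longrightarrow> (\<forall>x\<in>I. \<forall>y\<in>I. (x, y) \<notin> parcs G) \<Longrightarrow>
      \<exists>S'\<in>F. card S' = card S \<and> I \<subseteq> S'"
  proof (induction I)
    case empty
    then show ?case using S by blast
  next
    case (insert v I)
    then obtain S' where S': "S' \<in> F" "card S' = card S" "I \<subseteq> S'" by auto
    show ?case
    proof (cases "v \<in> S'")
      case False
      then obtain x where x: "x \<in> S'" "(x, v) \<in> parcs G" "insert v (S' - {x}) \<in> F"
        using eternal_response[OF F S'(1)] insert.prems by blast
      moreover have "finite S'"
        using F S' G dominating_finite eternal_dominating by blast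
      moreover have "x \<notin> I"
        using x insert.prems by blast
      ultimately show ?thesis
        using S' False card_swap[of S' x v] by (intro bexI[of _ "insert v (S' - {x})"]) auto
    qed (use S' in blast)
  qed
  with I obtain S' where "S' \<in> F" "card S' = card S" "I \<subseteq> S'" by blast
  moreover then have "finite S'"
    using F G dominating_finite eternal_dominating by blast
  ultimately show ?thesis by (metis card_mono)
qed

text \<open>\<open>f\<close> retracts the vertices onto \<open>I\<close> and its fibres are cliques,
  so there is a clique cover with one clique per element of \<open>I\<close>. One guard per clique
  suffices, and the independent set shows that fewer do not.\<close>

lemma eternal_domination_number_eq_independent:
  assumes G: "pair_graph G"
    and I: "I \<subseteq> pverts G" "\<And>x y. x \<in> I \<Longrightarrow> y \<in> I \<Longrightarrow> (x, y) \<notin> parcs G"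
    and f: "\<And>x. x \<in> pverts G \<Longrightarrow> f x \<in> I" "\<And>x. x \<in> I \<Longrightarrow> f x = x"
    and clique: "\<And>x y. x \<in> pverts G \<Longrightarrow> y \<in> pverts G \<Longrightarrow> f x = f y \<Longrightarrow> x \<noteq> y \<Longrightarrow> (x, y) \<in> parcs G"
  shows "eternal_domination_number G = card I"
proof (rule eternal_domination_number_eqI)
  let ?F = "{S. S \<subseteq> pverts G \<and> bij_betw f S I}"
  show "I \<in> ?F"
    using I(1) f(2) by (auto simp: bij_betw_def inj_on_def image_iff)
  have transversal: "\<exists>x\<in>S. f x = f v" if "S \<in> ?F" "v \<in> pverts G" for S v
    using that f(1) by (auto simp: bij_betw_def image_iff) (metis imageE)
  have dom: "dominating G S" if S: "S \<in> ?F" for S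
    unfolding dominating_def
    using S transversal[OF S] clique by (smt (verit) DiffD1 DiffD2 mem_Collect_eq subsetD)
  have "\<exists>S'\<in>?F. adjacent_sets G S S' \<and> v \<in> S'" if S: "S \<in> ?F" and v: "v \<in> pverts G - S" for S v
  proof -
    \<comment> \<open>The guard of the attacked fibre answers, so the new position again has one
      guard per fibre.\<close>
    obtain x where x: "x \<in> S" "f x = f v"
      using transversal[OF S] v by blast
    have "bij_betw f (insert v (S - {x})) I"
    proof -
      have "bij_betw f (S - {x}) (I - {f x})"
        using S x(1) inj_on_image_set_diff[of f S S "{x}"]
        by (auto simp: bij_betw_def intro: inj_on_diff)
      then have "bij_betw f (insert v (S - {x})) (insert (f v) (I - {f x}))"
        using x v by (auto simp: bij_betw_def)
      then show ?thesis using x v f(1) by (simp add: insert_absorb)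
    qed
    then have S': "insert v (S - {x}) \<in> ?F" using S v by blast
    moreover have "(x, v) \<in> parcs G" using x v S clique by blast
    ultimately show ?thesis
      using adjacent_setsI[OF dom[OF S] dom[OF S']] x v by blast
  qed
  with dom show "eternally_dominating_family G ?F"
    unfolding eternally_dominating_family_def by blast
qed (use eternal_independent_bound[OF G _ _ I] in auto)

text \<open>Symmetrizing and removing loops here lets the constructions list edges in one direction
  and describe cliques by plain membership.\<close>

definition graph_of :: "'a set \<Rightarrow> ('a \<Rightarrow> 'a \<Rightarrow> bool) \<Rightarrow> 'a pair_pre_digraph" where
  "graph_of V E = \<lparr>pverts = V, parcs = {(x, y). x \<in> V \<and> y \<in> V \<and> x \<noteq> y \<and> (E x y \<or> E y x)}\<rparr>"

lemma graph_of_simps [simp]: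
  "pverts (graph_of V E) = V"
  "(x, y) \<in> parcs (graph_of V E) \<longleftrightarrow> x \<in> V \<and> y \<in> V \<and> x \<noteq> y \<and> (E x y \<or> E y x)"
  by (auto simp: graph_of_def)

lemma pair_graph_graph_of: "finite V \<Longrightarrow> pair_graph (graph_of V E)"
  by unfold_locales
    (auto simp: graph_of_def symmetric_def intro!: symI intro: finite_subset[of _ "V \<times> V"])

section \<open>Adding an isolated vertex\<close>

definition add_isolated :: "'a \<Rightarrow> 'a pair_pre_digraph \<Rightarrow> 'a pair_pre_digraph" where
  "add_isolated w G = \<lparr>pverts = insert w (pverts G), parcs = parcs G\<rparr>"

context
  fixes G :: "'a pair_pre_digraph" and w :: 'a
  assumes G: "pair_graph G" and w: "w \<notin> pverts G"
begin

interpretation pair_graph G by (fact G)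

lemma pair_graph_add_isolated: "pair_graph (add_isolated w G)"
  using pair_finite_verts pair_sym_arcs pair_no_loops arc_fst_in_verts arc_snd_in_verts
  by unfold_locales (auto simp: add_isolated_def symmetric_def)

private lemma no_arc: "(w, x) \<notin> parcs G" "(x, w) \<notin> parcs G"
  using w arc_fst_in_verts arc_snd_in_verts by force+

private lemma dominating_imp: "dominating (add_isolated w G) S \<Longrightarrow> w \<in> S"
  using no_arc by (fastforce simp: dominating_def add_isolated_def)

private lemma dominating_iff:
  "w \<notin> S \<Longrightarrow> dominating (add_isolated w G) (insert w S) \<longleftrightarrow> dominating G S"
  using no_arc w by (auto simp: dominating_def add_isolated_def)

private lemma dominating_notin: "dominating G S \<Longrightarrow> w \<notin> S"
  using w by (auto simp: dominating_def)

text \<open>No arc meets \<open>w\<close>, so the guard there never moves, and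
  \<open>insert w\<close> can be cancelled on both sides of a move.\<close>

private lemma adjacent_iff:
  assumes "w \<notin> S" "w \<notin> T"
  shows "adjacent_sets (add_isolated w G) (insert w S) (insert w T) \<longleftrightarrow> adjacent_sets G S T"
proof -
  have *: "insert w T = insert w S - {x} \<union> {y} \<longleftrightarrow> T = S - {x} \<union> {y}" if "(x, y) \<in> parcs G" for x y
  proof -
    have "insert w S - {x} \<union> {y} = insert w (S - {x} \<union> {y})" "w \<notin> S - {x} \<union> {y}"
      using that assms no_arc by auto
    then show ?thesis using assms by (metis insert_ident)
  qed
  have **: "parcs (add_isolated w G) = parcs G" by (simp add: add_isolated_def)
  show ?thesis
    unfolding adjacent_sets_def ** dominating_iff[OF assms(1)] dominating_iff[OF assms(2)]
  proof (intro conj_cong refl iffI; elim bexE conjE)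
    fix x y assume "x \<in> insert w S" "y \<in> insert w T - insert w S" "(x, y) \<in> parcs G"
      "insert w T = insert w S - {x} \<union> {y}"
    with * no_arc show "\<exists>x\<in>S. \<exists>y\<in>T - S. (x, y) \<in> parcs G \<and> T = S - {x} \<union> {y}"
      by (intro bexI[of _ x] bexI[of _ y]) auto
  next
    fix x y assume "x \<in> S" "y \<in> T - S" "(x, y) \<in> parcs G" "T = S - {x} \<union> {y}"
    with * assms show "\<exists>x\<in>insert w S. \<exists>y\<in>insert w T - insert w S.
        (x, y) \<in> parcs G \<and> insert w T = insert w S - {x} \<union> {y}"
      by (intro bexI[of _ x] bexI[of _ y]) auto
  qed
qed

private lemma eternal_iff:
  assumes "\<forall>S\<in>F. w \<notin> S"
  shows "eternally_dominating_family (add_isolated w G) (insert w ` F) \<longleftrightarrow>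
    eternally_dominating_family G F"
proof -
  have "(\<forall>v\<in>pverts (add_isolated w G) - insert w S.
      \<exists>S'\<in>insert w ` F. adjacent_sets (add_isolated w G) (insert w S) S' \<and> v \<in> S') \<longleftrightarrow>
    (\<forall>v\<in>pverts G - S. \<exists>S'\<in>F. adjacent_sets G S S' \<and> v \<in> S')" if "S \<in> F" for S
  proof -
    have "pverts (add_isolated w G) - insert w S = pverts G - S"
      using w by (auto simp: add_isolated_def)
    moreover have "(\<exists>S'\<in>insert w ` F. adjacent_sets (add_isolated w G) (insert w S) S' \<and> v \<in> S') \<longleftrightarrow>
      (\<exists>S'\<in>F. adjacent_sets G S S' \<and> v \<in> S')" if "v \<in> pverts G - S" for v
      using that \<open>S \<in> F\<close> assms adjacent_iff w by auto
    ultimately show ?thesis by auto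
  qed
  then show ?thesis
    using assms dominating_iff unfolding eternally_dominating_family_def by simp
qed

text \<open>Beyond the eternal conditions only closure has to be transferred: every position
  reachable in the enlarged graph contains \<open>w\<close>, hence corresponds to a position of
  \<open>G\<close>.\<close>

private lemma autonomous_iff:
  assumes "\<forall>S\<in>F. w \<notin> S"
  shows "autonomously_dominating_family (add_isolated w G) (insert w ` F) \<longleftrightarrow>
    autonomously_dominating_family G F"
proof -
  let ?H = "add_isolated w G"
  have "(\<forall>S'. dominating ?H S' \<and> adjacent_sets ?H (insert w S) S' \<longrightarrow> S' \<in> insert w ` F) \<longleftrightarrow>
     (\<forall>S'. dominating G S' \<and> adjacent_sets G S S' \<longrightarrow> S' \<in> F)" (is "?L \<longleftrightarrow> ?R") if S: "S \<in> F" for S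
  proof
    assume L: ?L
    show ?R
    proof safe
      fix S' assume S': "dominating G S'" "adjacent_sets G S S'"
      then have "w \<notin> S'" using dominating_notin by blast
      with S' S assms have "dominating ?H (insert w S')" "adjacent_sets ?H (insert w S) (insert w S')"
        using adjacent_iff[of S S'] dominating_iff[of S'] by auto
      then have "insert w S' \<in> insert w ` F"
        using L by blast
      then obtain T where "T \<in> F" "insert w S' = insert w T" by blast
      moreover from this have "S' = T"
        using assms \<open>w \<notin> S'\<close> insert_ident[of w S' T] by simp
      ultimately show "S' \<in> F" by simp
    qed
  next
    assume R: ?R
    show ?L
    proof safe
      fix S' assume S': "dominating ?H S'" "adjacent_sets ?H (insert w S) S'"
      define T where "T = S' - {w}"
      then have T: "w \<notin> T" "S' = insert w T"
        using dominating_imp[OF S'(1)] by auto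
      then have "dominating G T" "adjacent_sets G S T"
        using S' S assms adjacent_iff[of S T] dominating_iff[of T] by auto
      with R T show "S' \<in> insert w ` F" by blast
    qed
  qed
  then show ?thesis
    using eternal_iff[OF assms]
    unfolding autonomously_dominating_family_def eternally_dominating_family_def by auto
qed

text \<open>Nothing else dominates the isolated vertex, so it lies in every member. Thus every
  family of the enlarged graph has the form to which the equivalences above apply.\<close>

private lemma strip_family:
  assumes "\<forall>S\<in>F. dominating (add_isolated w G) S"
  obtains F' where "F = insert w ` F'" and "\<forall>S\<in>F'. w \<notin> S"
proof
  have "insert w (S - {w}) = S" if "S \<in> F" for S
    using that assms dominating_imp by blast
  then show "F = insert w ` (\<lambda>S. S - {w}) ` F"
    by (simp add: image_image)
qed auto

text \<open>Applied with \<open>P\<close> and \<open>Q\<close> describing the attained sizes in the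
  enlarged and in the original graph.\<close>

private lemma Least_Suc_shift:
  assumes "\<And>k. P k \<longleftrightarrow> (\<exists>j. k = Suc j \<and> Q j)" and "\<exists>j. Q j"
  shows "(LEAST k. P k) = Suc (LEAST k. Q k)"
proof -
  obtain j where "P (Suc j)" using assms by auto
  moreover have "\<not> P 0" using assms(1) by simp
  ultimately have "(LEAST k. P k) = Suc (LEAST k. P (Suc k))" by (rule Least_Suc)
  then show ?thesis using assms(1) by simp
qed

private lemma card_insert_w: "dominating G S \<Longrightarrow> card (insert w S) = Suc (card S)"
  using dominating_notin dominating_finite[OF G] by simp

lemma domination_number_add_isolated:
  "domination_number (add_isolated w G) = Suc (domination_number G)"
  unfolding domination_number_def
proof (rule Least_Suc_shift)
  show "(\<exists>S. dominating (add_isolated w G) S \<and> card S = k) \<longleftrightarrow>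
      (\<exists>j. k = Suc j \<and> (\<exists>S. dominating G S \<and> card S = j))" for k
  proof safe
    fix S assume S: "dominating (add_isolated w G) S"
    then have *: "S = insert w (S - {w})" using dominating_imp by blast
    with S have "dominating G (S - {w})" by (metis Diff_iff dominating_iff singletonI)
    with * show "\<exists>j. card S = Suc j \<and> (\<exists>S. dominating G S \<and> card S = j)"
      using card_insert_w by metis
  next
    fix S assume "dominating G S"
    then show "\<exists>T. dominating (add_isolated w G) T \<and> card T = Suc (card S)"
      using dominating_iff dominating_notin card_insert_w by blast
  qed
  have "dominating G (pverts G)" by (simp add: dominating_def)
  then show "\<exists>j S. dominating G S \<and> card S = j" by metis
qed

lemma eternal_domination_number_add_isolated:
  "eternal_domination_number (add_isolated w G) = Suc (eternal_domination_number G)"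
  unfolding eternal_domination_number_def
proof (rule Least_Suc_shift)
  show "(\<exists>F S. eternally_dominating_family (add_isolated w G) F \<and> S \<in> F \<and> card S = k) \<longleftrightarrow>
      (\<exists>j. k = Suc j \<and> (\<exists>F S. eternally_dominating_family G F \<and> S \<in> F \<and> card S = j))" for k
  proof safe
    fix F S assume F: "eternally_dominating_family (add_isolated w G) F" and S: "S \<in> F"
    obtain F' where F': "F = insert w ` F'" "\<forall>S\<in>F'. w \<notin> S"
      using strip_family F eternal_dominating by metis
    with S obtain S' where "S' \<in> F'" "S = insert w S'" by blast
    then show "\<exists>j. card S = Suc j \<and> (\<exists>F S. eternally_dominating_family G F \<and> S \<in> F \<and> card S = j)"
      using F F' eternal_iff card_insert_w eternal_dominating by metis
  next
    fix F S assume F: "eternally_dominating_family G F" and S: "S \<in> F"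
    then have "eternally_dominating_family (add_isolated w G) (insert w ` F)"
      using eternal_iff eternal_dominating dominating_notin by blast
    then show "\<exists>F' S'. eternally_dominating_family (add_isolated w G) F' \<and> S' \<in> F' \<and>
        card S' = Suc (card S)"
      using F S card_insert_w eternal_dominating by blast
  qed
  show "\<exists>j F S. eternally_dominating_family G F \<and> S \<in> F \<and> card S = j"
    using autonomous_dominating_pverts[of G] autonomous_imp_eternal[of G]
    unfolding autonomous_dominating_def by metis
qed

lemma autonomous_domination_number_add_isolated:
  "autonomous_domination_number (add_isolated w G) = Suc (autonomous_domination_number G)"
  unfolding autonomous_domination_number_def
proof (rule Least_Suc_shift)
  show "(\<exists>S. autonomous_dominating (add_isolated w G) S \<and> card S = k) \<longleftrightarrow>
      (\<exists>j. k = Suc j \<and> (\<exists>S. autonomous_dominating G S \<and> card S = j))" for k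
    unfolding autonomous_dominating_def
  proof safe
    fix F S assume F: "autonomously_dominating_family (add_isolated w G) F" and S: "S \<in> F"
    obtain F' where F': "F = insert w ` F'" "\<forall>S\<in>F'. w \<notin> S"
      using strip_family F eternal_dominating autonomous_imp_eternal by metis
    with S obtain S' where "S' \<in> F'" "S = insert w S'" by blast
    moreover from this have "card S = Suc (card S')"
      using F F' autonomous_iff card_insert_w eternal_dominating autonomous_imp_eternal by metis
    ultimately show "\<exists>j. card S = Suc j \<and>
        (\<exists>S. (\<exists>F. autonomously_dominating_family G F \<and> S \<in> F) \<and> card S = j)"
      using F F' autonomous_iff by blast
  next
    fix F S assume F: "autonomously_dominating_family G F" and S: "S \<in> F"
    then have dom: "\<forall>S\<in>F. dominating G S"
      using autonomous_imp_eternal eternal_dominating by blast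
    then have "autonomously_dominating_family (add_isolated w G) (insert w ` F)"
      using autonomous_iff dominating_notin F by simp
    then show "\<exists>S'. (\<exists>F. autonomously_dominating_family (add_isolated w G) F \<and> S' \<in> F) \<and>
        card S' = Suc (card S)"
      using S dom card_insert_w by blast
  qed
  show "\<exists>j S. autonomous_dominating G S \<and> card S = j"
    using autonomous_dominating_pverts[of G] by metis
qed

end

section \<open>A hub with leaves: domination number one\<close>

text \<open>The intended sizes are \<open>card L = b - 2\<close> and
  \<open>card D = c - b + 1\<close>. Besides \<open>u\<close>, only \<open>w\<close> is adjacent to
  \<open>v\<close>, so \<open>v\<close> is what a departure of the hub guard endangers.\<close>

locale hub =
  fixes u v w :: 'a and D L :: "'a set"
  assumes finite: "finite D" "finite L"
    and nonempty: "D \<noteq> {}" "L \<noteq> {}"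
    and distinct: "u \<noteq> v" "u \<noteq> w" "v \<noteq> w" "u \<notin> D" "v \<notin> D" "w \<notin> D" "u \<notin> L" "v \<notin> L" "w \<notin> L"
      "D \<inter> L = {}"
begin

definition "V = {u, v, w} \<union> D \<union> L"

definition "H = graph_of V
  (\<lambda>x y. x = u \<or> x = v \<and> y = w \<or> x \<in> insert w D \<and> y \<in> insert w D)"

lemma pverts_H [simp]: "pverts H = V"
  by (simp add: H_def)

lemma arc_iff: "(x, y) \<in> parcs H \<longleftrightarrow> x \<in> V \<and> y \<in> V \<and> x \<noteq> y \<and>
    (x = u \<or> y = u \<or> x = v \<and> y = w \<or> x = w \<and> y = v \<or> x \<in> insert w D \<and> y \<in> insert w D)"
  by (auto simp: H_def)

lemma finite_V: "finite V"
  using finite by (simp add: V_def)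

lemma pair_graph_H: "pair_graph H"
  unfolding H_def using finite_V by (rule pair_graph_graph_of)

lemma leaf_arc: "p \<in> L \<Longrightarrow> (x, p) \<in> parcs H \<Longrightarrow> x = u"
  using distinct by (auto simp: arc_iff)

lemma dominating_hub: "S \<subseteq> V \<Longrightarrow> u \<in> S \<Longrightarrow> dominating H S"
  using distinct by (auto simp: dominating_def arc_iff V_def)

text \<open>Apart from the leaves, every other vertex is a neighbour of \<open>w\<close>.\<close>

lemma dominating_leaves_w: "S \<subseteq> V \<Longrightarrow> L \<subseteq> S \<Longrightarrow> w \<in> S \<Longrightarrow> dominating H S"
  unfolding dominating_def pverts_H
  by (intro conjI ballI bexI[of _ w]) (auto simp: arc_iff V_def)

lemma leaves_subset: "dominating H S \<Longrightarrow> u \<notin> S \<Longrightarrow> L \<subseteq> S"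
  using leaf_arc unfolding dominating_def V_def pverts_H by blast

lemma domination_number_H: "domination_number H = 1"
proof (rule domination_number_eqI)
  show "dominating H {u}"
    by (rule dominating_hub) (auto simp: V_def)
  fix S assume S: "dominating H S"
  then have "S \<noteq> {}" by (auto simp: dominating_def V_def)
  with dominating_finite[OF pair_graph_H S] show "1 \<le> card S"
    by (simp add: Suc_le_eq card_gt_0_iff)
qed simp

text \<open>The leaves, \<open>v\<close> and one \<open>d\<close> in \<open>D\<close> are
  independent. The matching clique cover consists of singletons for the leaves and \<open>v\<close>,
  together with the clique formed by \<open>u\<close>, \<open>w\<close> and
  \<open>D\<close>.\<close>

lemma eternal_domination_number_H: "eternal_domination_number H = card L + 2"
proof -
  obtain d where d: "d \<in> D" using nonempty by blast
  have "eternal_domination_number H = card (insert v (insert d L))"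
  proof (rule eternal_domination_number_eq_independent
      [where f = "\<lambda>x. if x \<in> insert v L then x else d", OF pair_graph_H])
    fix x y
    show "x \<in> insert v (insert d L) \<Longrightarrow> y \<in> insert v (insert d L) \<Longrightarrow> (x, y) \<notin> parcs H"
      using d distinct by (auto simp: arc_iff)
    show "x \<in> pverts H \<Longrightarrow> y \<in> pverts H \<Longrightarrow>
        (if x \<in> insert v L then x else d) = (if y \<in> insert v L then y else d) \<Longrightarrow> x \<noteq> y \<Longrightarrow>
        (x, y) \<in> parcs H"
      using d distinct by (auto simp: arc_iff V_def split: if_splits)
  qed (use d in \<open>auto simp: V_def\<close>)
  also have "\<dots> = card L + 2"
    using d distinct finite by (subst card_insert_disjoint; auto)+
  finally show ?thesis .
qed

text \<open>Pure counting: \<open>u\<close>, \<open>w\<close>, all of \<open>D\<close> and all but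
  one leaf already need \<open>card L + card D + 1\<close> guards.\<close>

lemma card_core:
  assumes "S \<subseteq> V" and "card S \<le> card L + card D" and "u \<in> S" and "L - {p} \<subseteq> S" and "w \<in> S"
  shows "\<not> D \<subseteq> S"
proof
  assume "D \<subseteq> S"
  with assms have "insert u (insert w (D \<union> (L - {p}))) \<subseteq> S" by auto
  then have "card (insert u (insert w (D \<union> (L - {p})))) \<le> card S"
    using assms(1) finite_V finite_subset by (metis card_mono)
  moreover have "card (insert u (insert w (D \<union> (L - {p})))) = 2 + card D + card (L - {p})"
    using distinct finite
    by (subst card_insert_disjoint card_Un_disjoint; auto)+
  moreover have "card L \<le> Suc (card (L - {p}))"
    using finite by (auto simp: card_Diff_singleton_if)
  ultimately show False using assms(2) by simp
qed

section \<open>Lower bound for autonomous families on the hub graph\<close>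

context
  fixes F
  assumes F: "autonomously_dominating_family H F"
begin

lemma in_family:
  assumes "S \<in> F"
  shows "S \<subseteq> V" "dominating H S" "finite S"
proof -
  show "dominating H S"
    using eternal_dominating[OF autonomous_imp_eternal[OF F] assms] .
  then show "S \<subseteq> V" "finite S"
    using dominating_finite[OF pair_graph_H] by (simp_all add: dominating_def)
qed

text \<open>A position with a guard at \<open>u\<close> dominates wherever the others stand, so
  closure permits such moves freely.\<close>

lemma move_below_hub:
  assumes "S \<in> F" and "x \<in> S" and "y \<notin> S" and "(x, y) \<in> parcs H" and "u = y \<or> u \<in> S - {x}"
  shows "insert y (S - {x}) \<in> F"
  using F assms(1-4)
proof (rule autonomous_move)
  have "y \<in> V" using assms(4) by (simp add: arc_iff)
  then show "dominating H (insert y (S - {x}))"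
    using assms(1,5) in_family(1) by (intro dominating_hub) auto
qed

text \<open>An attack on the vacant leaf \<open>p\<close> calls away the hub guard. With too few
  guards, the others can first be herded off \<open>w\<close> and \<open>v\<close> into
  \<open>D\<close>; then this attack leaves \<open>v\<close> undominated.\<close>

lemma missing_leaf:
  assumes "S0 \<in> F" and "u \<in> S0" and p: "p \<in> L" "p \<notin> S0"
  shows "card L + card D < card S0"
proof (rule ccontr)
  assume small: "\<not> card L + card D < card S0"
  let ?P = "\<lambda>S. S \<in> F \<and> u \<in> S \<and> p \<notin> S \<and> card S = card S0"
  have attack_leaf: "insert p (S - {u}) \<in> F" if "?P S" for S
  proof -
    obtain x where "(x, p) \<in> parcs H" "insert p (S - {x}) \<in> F"
      using eternal_response[OF autonomous_imp_eternal[OF F], of S p] \<open>?P S\<close> p(1) V_def by auto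
    then show ?thesis using leaf_arc p(1) by blast
  qed
  \<comment> \<open>After the forced answer \<open>u\<close> is vacant, so each remaining leaf must
    carry its own guard.\<close>
  have leaves: "L - {p} \<subseteq> S" if "?P S" for S
    using leaves_subset[OF in_family(2)[OF attack_leaf[OF that]]] p(1) distinct that by auto
  have "\<exists>S. ?P S" using assms by blast
  moreover have "\<forall>S. ?P S \<longrightarrow> card (S \<inter> D) < Suc (card D)"
    using finite by (simp add: card_mono le_imp_less_Suc)
  ultimately obtain S where S: "?P S" and
    max: "\<And>T. ?P T \<Longrightarrow> card (T \<inter> D) \<le> card (S \<inter> D)"
    using ex_has_greatest_nat[of ?P _ "\<lambda>S. card (S \<inter> D)" "Suc (card D)"] by blast
  \<comment> \<open>A guard at \<open>w\<close> could step to a vacant vertex of \<open>D\<close>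
    and beat the maximum. The claim covers every maximal \<open>T\<close> because it is also applied
    to the position after a move from \<open>v\<close> to \<open>w\<close>.\<close>
  have no_w: "w \<notin> T" if T: "?P T" "card (T \<inter> D) = card (S \<inter> D)" for T
  proof
    assume "w \<in> T"
    with T obtain d where d: "d \<in> D" "d \<notin> T"
      using card_core[of T p] leaves in_family small by (metis insertCI linorder_not_le subsetI)
    have "insert d (T - {w}) \<in> F"
      using T \<open>w \<in> T\<close> d distinct by (intro move_below_hub) (auto simp: arc_iff V_def)
    then have "?P (insert d (T - {w}))"
      using T d \<open>w \<in> T\<close> p(1) distinct card_swap[of T w d] in_family(3)[of T] by auto
    then have "card (insert d (T - {w}) \<inter> D) \<le> card (S \<inter> D)" by (rule max)
    moreover have "insert d (T - {w}) \<inter> D = insert d (T \<inter> D)"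
      using d distinct by auto
    ultimately show False using d T finite by simp
  qed
  have no_v: "v \<notin> S"
  proof
    assume "v \<in> S"
    have "w \<notin> S" using no_w S by simp
    have "insert w (S - {v}) \<in> F"
      using S \<open>v \<in> S\<close> \<open>w \<notin> S\<close> distinct
      by (intro move_below_hub) (auto simp: arc_iff V_def)
    then have "?P (insert w (S - {v}))"
      using S \<open>v \<in> S\<close> \<open>w \<notin> S\<close> p(1) distinct
        card_swap[of S v w] in_family(3)[of S] by auto
    moreover have "insert w (S - {v}) \<inter> D = S \<inter> D"
      using distinct by auto
    ultimately show False using no_w[of "insert w (S - {v})"] by simp
  qed
  have "dominating H (insert p (S - {u}))"
    using attack_leaf S in_family by blast
  then have "\<exists>x\<in>insert p (S - {u}). (x, v) \<in> parcs H"
    using no_v p(1) distinct by (auto simp: dominating_def V_def)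
  then show False
    using no_w[OF S] p(1) distinct by (auto simp: arc_iff)
qed

text \<open>With too few guards \<open>u\<close> must always be occupied, and then by
  \<open>missing_leaf\<close> all leaves as well. But once \<open>w\<close> is occupied, some vertex
  of \<open>D\<close> is vacant and the hub guard may move there, since \<open>w\<close> and the
  leaves still dominate.\<close>

lemma autonomous_bound:
  assumes "S0 \<in> F"
  shows "card L + card D < card S0"
proof (rule ccontr)
  assume small: "\<not> card L + card D < card S0"
  obtain p where p: "p \<in> L" using nonempty by blast
  \<comment> \<open>If \<open>u\<close> were vacant, all leaves would be occupied, and moving the
    guard at \<open>p\<close> to \<open>u\<close> would give a position excluded by
    \<open>missing_leaf\<close>.\<close>
  have off_hub: False if S: "S \<in> F" "card S = card S0" "u \<notin> S" for S
  proof -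
    have "p \<in> S" using leaves_subset S p in_family by blast
    then have "insert u (S - {p}) \<in> F"
      using S p distinct by (intro move_below_hub) (auto simp: arc_iff V_def)
    moreover have "p \<noteq> u" using p distinct by blast
    ultimately have "card L + card D < card (insert u (S - {p}))"
      using p by (intro missing_leaf) auto
    then show False
      using small S \<open>p \<in> S\<close> card_swap in_family(3) by metis
  qed
  obtain S where S: "S \<in> F" "w \<in> S" "card S = card S0"
    using eternal_occupy[OF pair_graph_H autonomous_imp_eternal[OF F] assms, of w]
    by (auto simp: V_def)
  then have u: "u \<in> S" using off_hub by blast
  have leaves: "L \<subseteq> S"
    using missing_leaf[OF S(1) u] S small by auto
  then obtain d where d: "d \<in> D" "d \<notin> S"
    using card_core[of S p] S u small in_family(1)
    by (metis Diff_subset insertCI linorder_not_le subsetI subset_trans)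
  have "insert d (S - {u}) \<in> F"
    using F S(1) u d(2)
  proof (rule autonomous_move)
    show "(u, d) \<in> parcs H"
      using d distinct by (auto simp: arc_iff V_def)
    show "dominating H (insert d (S - {u}))"
      using in_family(1)[OF S(1)] S(2) d leaves distinct
      by (intro dominating_leaves_w) (auto simp: V_def)
  qed
  then show False
    using off_hub[of "insert d (S - {u})"] S u d distinct
      card_swap[of S u d] in_family(3)[of S] by auto
qed

end

text \<open>As \<open>V\<close> has \<open>card L + card D + 3\<close> vertices, positions of this
  size leave exactly two vacant.\<close>

lemma autonomous_domination_number_H: "autonomous_domination_number H = card L + card D + 1"
proof (rule autonomous_domination_number_eqI)
  define X where "X = insert v (insert w D)"
  \<comment> \<open>Such a position has two vacant vertices; the leaves are safe as long as one of them is in \<open>X\<close>.\<close>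
  define F where "F = {V - {x, y} | x y. x \<in> X \<and> y \<in> V \<and> x \<noteq> y}"
  have XV: "X \<subseteq> V" and Xu: "u \<notin> X" and XL: "X \<inter> L = {}"
    using distinct by (auto simp: X_def V_def)
  have X_nbr: "\<exists>n\<in>X. (n, x) \<in> parcs H" if "x \<in> X" for x
    using that nonempty distinct by (auto simp: X_def arc_iff V_def)
  have dom: "dominating H (V - {x, y})" if "x \<in> X" "y \<in> V" "x \<noteq> y" for x y
  \<comment> \<open>The critical case is \<open>u\<close> vacant: then \<open>x\<close> is dominated
    from within \<open>X\<close>, and \<open>u\<close> by a leaf.\<close>
  proof (cases "y = u")
    case True
    obtain n where n: "n \<in> X" "(n, x) \<in> parcs H" using X_nbr \<open>x \<in> X\<close> by blast
    obtain p where p: "p \<in> L" using nonempty by blast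
    have "(p, u) \<in> parcs H" "p \<in> V - {x, y}" "n \<in> V - {x, y}"
      using p n distinct True XL XV Xu \<open>x \<in> X\<close> by (auto simp: arc_iff V_def)
    with n True show ?thesis unfolding dominating_def by auto
  next
    case False
    with that Xu show ?thesis by (intro dominating_hub) (auto simp: V_def)
  qed
  have attack: "\<exists>S'\<in>F. adjacent_sets H (V - {x, y}) S' \<and> a \<in> S'"
    if xy: "x \<in> X" "y \<in> V" "x \<noteq> y" and a: "a \<in> {x, y}" for x y a
  proof -
    define b where "b = (if a = x then y else x)"
    have ab: "{x, y} = {a, b}" "a \<noteq> b" "a \<in> V" "b \<in> V"
      using a xy XV by (auto simp: b_def)
    \<comment> \<open>After the move from \<open>n\<close> to \<open>a\<close> the vacancies are
      \<open>n\<close> and \<open>b\<close>, and one of them has to lie in \<open>X\<close>. If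
      \<open>b\<close> does not, then \<open>a\<close> does, and it has an occupied neighbour in
      \<open>X\<close>.\<close>
    have "\<exists>n\<in>V - {x, y}. (n, a) \<in> parcs H \<and> (n \<in> X \<or> b \<in> X)"
    proof (cases "b \<in> X")
      case True
      moreover have "\<exists>n\<in>V - {x, y}. (n, a) \<in> parcs H"
        using dom[OF xy] a xy XV unfolding dominating_def by auto
      ultimately show ?thesis by blast
    next
      case False
      then have "a \<in> X" using xy(1) a by (auto simp: b_def split: if_splits)
      then obtain n where n: "n \<in> X" "(n, a) \<in> parcs H" using X_nbr by blast
      then have "n \<in> V - {a, b}" using False XV by (auto simp: arc_iff)
      with n ab(1) show ?thesis by auto
    qed
    then obtain n where n: "n \<in> V - {a, b}" "(n, a) \<in> parcs H" "n \<in> X \<or> b \<in> X"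
      using ab(1) by auto
    have eq: "insert a (V - {a, b} - {n}) = V - {b, n}"
      using n ab by auto
    have "V - {b, n} \<in> F"
      using n ab unfolding F_def by (auto simp: insert_commute)
    moreover have "dominating H (V - {b, n})"
      using n ab dom[of b n] dom[of n b] by (auto simp: insert_commute)
    then have "adjacent_sets H (V - {a, b}) (V - {b, n})"
      using adjacent_setsI[of H "V - {a, b}" a n] dom[OF xy] n eq ab by auto
    ultimately show ?thesis
      using ab n by (intro bexI[of _ "V - {b, n}"]) auto
  qed
  have closed: "S' \<in> F"
    if xy: "x \<in> X" "y \<in> V" "x \<noteq> y" and S': "dominating H S'" "adjacent_sets H (V - {x, y}) S'"
    for x y S'
  proof -
    obtain n a where n: "n \<in> V - {x, y}" "a \<notin> V - {x, y}" "(n, a) \<in> parcs H"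
      "S' = insert a (V - {x, y} - {n})"
      using S'(2) by (rule adjacent_setsE)
    have "a \<in> V" using n(3) by (simp add: arc_iff)
    then consider "a = y" | "a = x" using n(2) by blast
    then show ?thesis
    proof cases
      case 1
      then have "S' = V - {x, n}" using n xy by auto
      then show ?thesis using n xy unfolding F_def by blast
    next
      case 2
      then have eq: "S' = V - {n, y}" using n xy XV by auto
      \<comment> \<open>Otherwise \<open>a\<close> in \<open>X\<close> was filled from outside
        \<open>X\<close>, which is possible only from \<open>u\<close>; the other vacancy
        \<open>y\<close> is then a leaf whose only neighbour has just been vacated.\<close>
      have "n \<in> X \<or> y \<in> X"
      proof (rule ccontr)
        assume *: "\<not> (n \<in> X \<or> y \<in> X)"
        then have "n = u"
          using n(3) 2 xy(1) distinct by (auto simp: arc_iff X_def V_def)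
        moreover from this have "y \<in> L"
          using * n xy by (auto simp: X_def V_def)
        ultimately show False
          using leaves_subset[OF S'(1)] eq by blast
      qed
      then show ?thesis
        using eq n xy unfolding F_def by (auto simp: insert_commute)
    qed
  qed
  show fam: "autonomously_dominating_family H F"
    unfolding autonomously_dominating_family_def
  proof (intro conjI ballI allI impI; (elim conjE)?)
    fix S assume "S \<in> F"
    then obtain x y where xy: "S = V - {x, y}" "x \<in> X" "y \<in> V" "x \<noteq> y"
      unfolding F_def by blast
    show "dominating H S" using dom xy by blast
    show "\<exists>S'\<in>F. adjacent_sets H S S' \<and> a \<in> S'" if "a \<in> pverts H - S" for a
      using attack[OF xy(2-4), of a] that xy(1) by auto
    show "S' \<in> F" if "dominating H S'" "adjacent_sets H S S'" for S'
      using closed[OF xy(2-4)] that xy(1) by blast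
  qed
  show "V - {v, u} \<in> F"
    using distinct unfolding F_def X_def V_def by blast
  have "V - {v, u} = insert w (D \<union> L)"
    using distinct by (auto simp: V_def)
  then show "card (V - {v, u}) = card L + card D + 1"
    using finite distinct by (simp add: card_Un_disjoint)
qed (use autonomous_bound in fastforce)

end

section \<open>Two cliques: eternal domination number two\<close>

text \<open>In the application \<open>R a b\<close> says that \<open>b\<close> belongs to the set
  coded by \<open>a\<close>, and \<open>z\<close> codes the empty set.\<close>

locale two_cliques =
  fixes A B :: "'a set" and R :: "'a \<Rightarrow> 'a \<Rightarrow> bool" and z :: 'a
  assumes finite: "finite A" "finite B"
    and disjoint: "A \<inter> B = {}"
    and B_nonempty: "B \<noteq> {}"
    and z: "z \<in> A" "\<And>b. b \<in> B \<Longrightarrow> \<not> R z b"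
begin

definition "H = graph_of (A \<union> B)
  (\<lambda>x y. x \<in> A \<and> y \<in> A \<or> x \<in> B \<and> y \<in> B \<or> x \<in> A \<and> y \<in> B \<and> R x y)"

definition mixed :: "'a set \<Rightarrow> bool" where
  "mixed S \<longleftrightarrow> S \<inter> A \<noteq> {} \<and> S \<inter> B \<noteq> {}"

lemma pverts_H [simp]: "pverts H = A \<union> B"
  by (simp add: H_def)

lemma pair_graph_H: "pair_graph H"
  unfolding H_def using finite by (intro pair_graph_graph_of) simp

lemma arc_clique:
  "x \<in> A \<Longrightarrow> y \<in> A \<Longrightarrow> (x, y) \<in> parcs H \<longleftrightarrow> x \<noteq> y"
  "x \<in> B \<Longrightarrow> y \<in> B \<Longrightarrow> (x, y) \<in> parcs H \<longleftrightarrow> x \<noteq> y"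
  by (auto simp: H_def)

lemma arc_cross:
  "x \<in> A \<Longrightarrow> y \<in> B \<Longrightarrow> (x, y) \<in> parcs H \<longleftrightarrow> R x y"
  "x \<in> A \<Longrightarrow> y \<in> B \<Longrightarrow> (y, x) \<in> parcs H \<longleftrightarrow> R x y"
  using disjoint by (auto simp: H_def)

lemma dominating_mixed: "S \<subseteq> A \<union> B \<Longrightarrow> mixed S \<Longrightarrow> dominating H S"
  unfolding dominating_def mixed_def pverts_H using arc_clique by blast

text \<open>Read as subsets of \<open>B\<close>, the guards must cover \<open>B\<close>. Since
  \<open>B\<close> is nonempty, a cover has at least one guard, and that guard dominates the rest of
  the clique \<open>A\<close>.\<close>

lemma dominating_left:
  assumes "S \<subseteq> A"
  shows "dominating H S \<longleftrightarrow> (\<forall>b\<in>B. \<exists>a\<in>S. R a b)"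
proof
  assume "dominating H S"
  then show "\<forall>b\<in>B. \<exists>a\<in>S. R a b"
    using assms disjoint arc_cross(1) unfolding dominating_def
    by (metis DiffI UnCI disjoint_iff pverts_H subsetD)
next
  assume R: "\<forall>b\<in>B. \<exists>a\<in>S. R a b"
  then obtain a where a: "a \<in> S" using B_nonempty by blast
  show "dominating H S"
    unfolding dominating_def pverts_H
  proof (intro conjI ballI)
    fix x assume x: "x \<in> A \<union> B - S"
    show "\<exists>a\<in>S. (a, x) \<in> parcs H"
    proof (cases "x \<in> A")
      case True
      with x a assms show ?thesis by (intro bexI[of _ a]) (auto simp: arc_clique)
    next
      case False
      with x R assms arc_cross(1) show ?thesis by blast
    qed
  qed (use assms in blast)
qed

text \<open>All neighbours of \<open>z\<close> lie in \<open>A\<close>. So a dominating position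
  that is not mixed lies inside \<open>A\<close>.\<close>

lemma dominating_meets_left: "dominating H S \<Longrightarrow> S \<inter> A \<noteq> {}"
proof
  assume S: "dominating H S" and "S \<inter> A = {}"
  then have "S \<subseteq> B" by (auto simp: dominating_def)
  moreover obtain x where "x \<in> S" "(x, z) \<in> parcs H"
    using S \<open>S \<inter> A = {}\<close> z(1) unfolding dominating_def pverts_H by blast
  ultimately show False using arc_cross(2)[OF z(1)] z(2) by blast
qed

lemma dominating_cases:
  assumes "dominating H S"
  obtains "mixed S" | "S \<subseteq> A"
proof (cases "S \<inter> B = {}")
  case True
  with assms that(2) show thesis by (auto simp: dominating_def)
qed (use assms that(1) dominating_meets_left in \<open>auto simp: mixed_def\<close>)

section \<open>Domination and eternal domination of the two cliques\<close>

lemma domination_number_one: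
  assumes "t \<in> A" and "\<And>b. b \<in> B \<Longrightarrow> R t b"
  shows "domination_number H = 1"
proof (rule domination_number_eqI)
  show "dominating H {t}"
    using assms by (simp add: dominating_left)
  fix S assume S: "dominating H S"
  then have "S \<noteq> {}" using dominating_meets_left by blast
  with dominating_finite[OF pair_graph_H S] show "1 \<le> card S"
    by (simp add: Suc_le_eq card_gt_0_iff)
qed simp

lemma domination_number_two:
  assumes no_universal: "\<And>t. t \<in> A \<Longrightarrow> \<exists>b\<in>B. \<not> R t b"
  shows "domination_number H = 2"
proof -
  obtain b where b: "b \<in> B" using B_nonempty by blast
  show ?thesis
  proof (rule domination_number_eqI[of H "{z, b}"])
    show "dominating H {z, b}"
      using b z(1) by (intro dominating_mixed) (auto simp: mixed_def)
    show "card {z, b} = 2" using b z(1) disjoint by (subst card_2_iff) blast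
    fix S assume S: "dominating H S"
    then have fin: "finite S" by (rule dominating_finite[OF pair_graph_H])
    show "2 \<le> card S"
    proof (rule ccontr)
      assume "\<not> 2 \<le> card S"
      moreover obtain t where t: "t \<in> S" "t \<in> A" using dominating_meets_left[OF S] by blast
      ultimately have "S = {t}"
        using fin card_le_Suc0_iff_eq[of S] by auto
      then show False using S t no_universal by (auto simp: dominating_left)
    qed
  qed
qed

lemma eternal_domination_number_H: "eternal_domination_number H = 2"
proof -
  obtain b where b: "b \<in> B" using B_nonempty by blast
  then have "z \<noteq> b" using z(1) disjoint by blast
  have "eternal_domination_number H = card {z, b}"
  proof (rule eternal_domination_number_eq_independent
      [where f = "\<lambda>x. if x \<in> A then z else b", OF pair_graph_H])
    fix x y
    show "x \<in> {z, b} \<Longrightarrow> y \<in> {z, b} \<Longrightarrow> (x, y) \<notin> parcs H"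
      using z b arc_cross by (auto simp: arc_clique)
    show "x \<in> pverts H \<Longrightarrow> y \<in> pverts H \<Longrightarrow>
        (if x \<in> A then z else b) = (if y \<in> A then z else b) \<Longrightarrow> x \<noteq> y \<Longrightarrow> (x, y) \<in> parcs H"
      using \<open>z \<noteq> b\<close> by (auto simp: arc_clique split: if_splits)
  qed (use b z disjoint in auto)
  with \<open>z \<noteq> b\<close> show ?thesis by simp
qed

text \<open>\<open>T\<close> codes a partition of \<open>B\<close> into nonempty blocks. With
  \<open>card T\<close> guards the position \<open>T\<close> can be reached; an attack on
  \<open>z\<close> then pulls some guard away, and its block stays uncovered because
  \<open>z\<close> covers nothing.\<close>

lemma autonomous_card_neq:
  assumes F: "autonomously_dominating_family H F" and S0: "S0 \<in> F"
    and T: "T \<subseteq> A" "\<And>b. b \<in> B \<Longrightarrow> \<exists>!t. t \<in> T \<and> R t b" "\<And>t. t \<in> T \<Longrightarrow> \<exists>b\<in>B. R t b"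
    and "2 \<le> card T"
  shows "card S0 \<noteq> card T"
proof
  assume card: "card S0 = card T"
  note E = autonomous_imp_eternal[OF F]
  have finT: "finite T" using T(1) finite finite_subset by blast
  have fin: "finite S" and sub: "S \<subseteq> A \<union> B" if "S \<in> F" for S
    using eternal_dominating[OF E that] dominating_finite[OF pair_graph_H]
    by (simp_all add: dominating_def)
  have move: "insert y (S - {x}) \<in> F"
    if "S \<in> F" "x \<in> S" "y \<notin> S" "(x, y) \<in> parcs H" "y \<in> A \<union> B" "mixed (insert y (S - {x}))" for S x y
  proof -
    have "insert y (S - {x}) \<subseteq> A \<union> B" using sub[OF that(1)] that(5) by auto
    then show ?thesis
      using autonomous_move[OF F that(1-4)] dominating_mixed that(6) by simp
  qed
  define P where "P S \<longleftrightarrow> S \<in> F \<and> mixed S \<and> card S = card T" for S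
  have P_move: "P (insert y (S - {x}))"
    if "P S" "x \<in> S" "y \<notin> S" "(x, y) \<in> parcs H" "y \<in> A \<union> B" "mixed (insert y (S - {x}))" for S x y
    using that move[of S x y] card_swap[of S x y] fin[of S] by (simp add: P_def)
  have "\<exists>S. P S"
  proof -
    obtain S where S: "S \<in> F" "z \<in> S" "card S = card T"
      using eternal_occupy[OF pair_graph_H E S0, of z] z(1) card by auto
    show ?thesis
    proof (cases "S \<inter> B = {}")
      case False
      with S z(1) show ?thesis by (auto simp: P_def mixed_def)
    next
      case True
      obtain b where b: "b \<in> B" using B_nonempty by blast
      with True have "b \<notin> S" by blast
      then obtain x where x: "x \<in> S" "insert b (S - {x}) \<in> F"
        using eternal_response[OF E S(1), of b] b by auto
      \<comment> \<open>With at least two guards, one remains in \<open>A\<close> after the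
        answer.\<close>
      have "card (S - {x}) \<noteq> 0" using x(1) S(3) \<open>2 \<le> card T\<close> by simp
      then have "S - {x} \<noteq> {}" by (metis card.empty)
      moreover have "S \<subseteq> A" using True sub[OF S(1)] by blast
      ultimately have "mixed (insert b (S - {x}))" using b by (auto simp: mixed_def)
      with x \<open>b \<notin> S\<close> S show ?thesis
        using card_swap[of S x b] fin[of S] by (auto simp: P_def)
    qed
  qed
  moreover have "\<forall>S. P S \<longrightarrow> card (S \<inter> T) < Suc (card T)"
    using finT by (simp add: card_mono le_imp_less_Suc)
  \<comment> \<open>Maximal agreement with \<open>T\<close> among mixed positions makes \<open>S\<close> differ from \<open>T\<close> in one guard.\<close>
  ultimately obtain S where S: "P S"
    and max: "\<And>S'. P S' \<Longrightarrow> card (S' \<inter> T) \<le> card (S \<inter> T)"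
    using ex_has_greatest_nat[of P _ "\<lambda>S. card (S \<inter> T)" "Suc (card T)"] by blast
  \<comment> \<open>Stated for any \<open>S'\<close> that agrees with \<open>S\<close> on
    \<open>T\<close>, since one case below first shifts a guard inside \<open>B\<close>.\<close>
  have no_gain: False
    if S': "P S'" "S' \<inter> T = S \<inter> T" and xt: "x \<in> S' - T" "t \<in> T - S'" "(x, t) \<in> parcs H"
      and m: "mixed (insert t (S' - {x}))" for S' x t
  proof -
    have "P (insert t (S' - {x}))"
      using P_move[of S' x t] S' xt m T(1) by auto
    then have "card (insert t (S' - {x}) \<inter> T) \<le> card (S \<inter> T)" by (rule max)
    moreover have "insert t (S' - {x}) \<inter> T = insert t (S \<inter> T)" "t \<notin> S"
      using S' xt by auto
    ultimately show False using finT by simp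
  qed
  have inF: "S \<in> F" and mS: "mixed S" and cS: "card S = card T"
    using S by (auto simp: P_def)
  obtain b where b: "b \<in> S" "b \<in> B" using mS by (auto simp: mixed_def)
  \<comment> \<open>Equal sizes would force \<open>S = T\<close>, but \<open>b\<close> lies outside
    \<open>T\<close>.\<close>
  have "\<not> T \<subseteq> S"
    using card_subset_eq[OF fin[OF inF]] cS b T(1) disjoint by (metis disjoint_iff subsetD)
  then obtain t where t: "t \<in> T" "t \<notin> S" by blast
  have tA: "t \<in> A" using t T(1) by blast
  \<comment> \<open>A guard in \<open>A\<close> off \<open>T\<close> could step to \<open>t\<close>
    within the clique, while \<open>b\<close> keeps the position mixed.\<close>
  have left: "S \<inter> A \<subseteq> T"
  proof
    fix x assume x: "x \<in> S \<inter> A"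
    have "mixed (insert t (S - {x}))"
      using x b tA disjoint by (auto simp: mixed_def)
    moreover have "(x, t) \<in> parcs H"
      using x t tA by (auto simp: arc_clique)
    ultimately show "x \<in> T" using no_gain[OF S refl, of x t] x t by blast
  qed
  \<comment> \<open>\<open>b'\<close> serves as a gate through which a guard in \<open>B\<close> can
    enter \<open>t\<close>.\<close>
  obtain b' where b': "b' \<in> B" "R t b'" using T(3) t by blast
  then have arc: "(b', t) \<in> parcs H" using arc_cross(2)[OF tA] by simp
  have notT: "x \<notin> T" if "x \<in> B" for x using that T(1) disjoint by blast
  \<comment> \<open>With a second guard in \<open>B\<close>, one of them could pass through
    \<open>b'\<close> to \<open>t\<close> while the position stays mixed.\<close>
  have single: "c = b" if c: "c \<in> S" "c \<in> B" for c
  proof (rule ccontr)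
    assume "c \<noteq> b"
    show False
    proof (cases "b' \<in> S")
      case True
      have "mixed (insert t (S - {b'}))"
        using \<open>c \<noteq> b\<close> b c tA by (auto simp: mixed_def)
      then show False using no_gain[OF S refl, of b' t] True notT[OF b'(1)] t arc by blast
    next
      case False
      let ?S = "insert b' (S - {b})"
      have "P ?S"
        using P_move[OF S b(1) False] b b' mS disjoint False by (auto simp: arc_clique mixed_def)
      moreover have "?S \<inter> T = S \<inter> T"
        using notT b b' by auto
      moreover have "mixed (insert t (?S - {b'}))"
        using \<open>c \<noteq> b\<close> b c tA False by (auto simp: mixed_def)
      moreover have "t \<noteq> b'" using t b' notT by blast
      ultimately show False
        using no_gain[of ?S b' t] notT[OF b'(1)] t arc by blast
    qed
  qed
  have "S - {b} \<subseteq> T - {t}"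
    using single left sub[OF inF] t by blast
  moreover have "card (S - {b}) = card (T - {t})"
    using b t cS fin[OF inF] finT by simp
  ultimately have Sb: "S - {b} = T - {t}"
    using finT by (simp add: card_subset_eq)
  \<comment> \<open>Now \<open>S\<close> is \<open>T\<close> with \<open>t\<close> replaced by
    \<open>b\<close>; the one guard in \<open>B\<close> is brought to the gate.\<close>
  have "insert b' (T - {t}) \<in> F"
  proof (cases "b' = b")
    case True
    with Sb b inF show ?thesis by (metis insert_Diff)
  next
    case False
    then have "b' \<notin> S" using single b' by blast
    have "mixed (insert b' (S - {b}))"
      using mS b b' disjoint by (auto simp: mixed_def)
    moreover have "(b, b') \<in> parcs H"
      using b b' False by (simp add: arc_clique)
    ultimately have "insert b' (S - {b}) \<in> F"
      using move[OF inF b(1) \<open>b' \<notin> S\<close>] b' by simp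
    with Sb show ?thesis by simp
  qed
  moreover have eq: "insert t (insert b' (T - {t}) - {b'}) = T"
    using t notT[OF b'(1)] by auto
  \<comment> \<open>\<open>T\<close> is not mixed, so the last move rests on the covering criterion
    instead.\<close>
  moreover have "dominating H T"
    using T by (subst dominating_left) blast+
  moreover have "t \<notin> insert b' (T - {t})"
    using t notT[OF b'(1)] by auto
  ultimately have TF: "T \<in> F"
    using autonomous_move[OF F, of "insert b' (T - {t})" b' t] arc by simp
  \<comment> \<open>Attack \<open>z\<close>: the guard leaving \<open>x\<close> was the only one
    adjacent to \<open>c\<close>, and \<open>z\<close> is no substitute.\<close>
  have "z \<notin> T" using T(3) z(2) by blast
  then obtain x where x: "x \<in> T" "insert z (T - {x}) \<in> F"
    using eternal_response[OF E TF, of z] z(1) by auto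
  obtain c where c: "c \<in> B" "R x c" using T(3) x by blast
  have "dominating H (insert z (T - {x}))"
    using E x eternal_dominating by blast
  then obtain s where "s \<in> insert z (T - {x})" "R s c"
    using dominating_left[of "insert z (T - {x})"] T(1) z(1) c by blast
  then show False using T(2)[OF c(1)] c x z(2) by blast
qed

text \<open>Moves preserve size, so closure is automatic; the point is that every attack has a safe
  answer.\<close>

lemma autonomous_large:
  "autonomously_dominating_family H {S. dominating H S \<and> card S = card B + 1}"
    (is "autonomously_dominating_family H ?F")
  unfolding autonomously_dominating_family_def
proof (intro conjI ballI allI impI; (elim conjE)?)
  fix S assume "S \<in> ?F"
  then have dom: "dominating H S" and card: "card S = card B + 1" by auto
  then have fin: "finite S" using dominating_finite[OF pair_graph_H] by blast
  have sub: "S \<subseteq> A \<union> B" using dom by (auto simp: dominating_def)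
  show "dominating H S" by (fact dom)
  show "S' \<in> ?F" if "dominating H S'" "adjacent_sets H S S'" for S'
    using that card card_swap[OF fin] by (auto elim!: adjacent_setsE)
  fix v assume v: "v \<in> pverts H - S"
  have "\<exists>x\<in>S. (x, v) \<in> parcs H \<and> dominating H (insert v (S - {x}))"
    using dom
  proof (cases rule: dominating_cases)
    case 1
    \<comment> \<open>The guard in the clique of \<open>v\<close> answers, which keeps the position
      mixed.\<close>
    then obtain a b where ab: "a \<in> S" "a \<in> A" "b \<in> S" "b \<in> B" by (auto simp: mixed_def)
    then have "a \<noteq> b" using disjoint by blast
    show ?thesis
    proof (cases "v \<in> A")
      case True
      with ab \<open>a \<noteq> b\<close> v sub show ?thesis
        by (intro bexI[of _ a] conjI dominating_mixed) (auto simp: arc_clique mixed_def)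
    next
      case False
      with ab \<open>a \<noteq> b\<close> v sub show ?thesis
        by (intro bexI[of _ b] conjI dominating_mixed) (auto simp: arc_clique mixed_def)
    qed
  next
    case 2
    from dom 2 have "\<forall>b\<in>B. \<exists>a\<in>S. R a b" by (simp add: dominating_left)
    then obtain g where g: "\<And>b. b \<in> B \<Longrightarrow> g b \<in> S" "\<And>b. b \<in> B \<Longrightarrow> R (g b) b"
      by metis
    show ?thesis
    proof (cases "v \<in> A")
      case True
      \<comment> \<open>\<open>g\<close> selects at most \<open>card B\<close> guards that already
        cover \<open>B\<close>, so one of the \<open>card B + 1\<close> is spare and can
        answer.\<close>
      have "card (g ` B) < card S"
        using card card_image_le[OF finite(2), of g] by simp
      then have "\<not> S \<subseteq> g ` B"
        using card_mono[of "g ` B" S] finite(2) by fastforce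
      then obtain a where a: "a \<in> S" "a \<notin> g ` B" by blast
      then have "\<forall>b\<in>B. \<exists>s\<in>insert v (S - {a}). R s b"
        using g by blast
      then have "dominating H (insert v (S - {a}))"
        using True 2 by (subst dominating_left) auto
      then show ?thesis
        using a v True 2 by (intro bexI[of _ a]) (auto simp: arc_clique)
    next
      case False
      then have vB: "v \<in> B" using v by simp
      \<comment> \<open>A second guard in \<open>A\<close> makes the position mixed once
        \<open>g v\<close> has moved to \<open>v\<close>.\<close>
      have "card S \<noteq> 1" using card finite(2) B_nonempty by simp
      then have "S - {g v} \<noteq> {}"
        using g(1)[OF vB]
        by (metis Diff_eq_empty_iff card_1_singleton_iff empty_iff subset_singletonD One_nat_def)
      then have "mixed (insert v (S - {g v}))"
        using 2 vB by (auto simp: mixed_def)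
      then show ?thesis
        using g[OF vB] vB 2 sub arc_cross(1)[of "g v" v]
        by (intro bexI[of _ "g v"] conjI dominating_mixed) auto
    qed
  qed
  then obtain x where x: "x \<in> S" "(x, v) \<in> parcs H" "dominating H (insert v (S - {x}))"
    by blast
  then show "\<exists>S'\<in>?F. adjacent_sets H S S' \<and> v \<in> S'"
    using v dom card card_swap[OF fin, of x v]
    by (intro bexI[of _ "insert v (S - {x})"] conjI adjacent_setsI) auto
qed

text \<open>Sizes below two are excluded by an independent pair, sizes from two to
  \<open>card B\<close> by \<open>autonomous_card_neq\<close>.\<close>

lemma autonomous_domination_number_H:
  assumes "\<And>k. 2 \<le> k \<Longrightarrow> k \<le> card B \<Longrightarrow> \<exists>T. T \<subseteq> A \<and> card T = k \<and>
      (\<forall>b\<in>B. \<exists>!t. t \<in> T \<and> R t b) \<and> (\<forall>t\<in>T. \<exists>b\<in>B. R t b)"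
  shows "autonomous_domination_number H = card B + 1"
proof (rule autonomous_domination_number_eqI[OF autonomous_large])
  have "dominating H (insert z B)"
    using z B_nonempty by (intro dominating_mixed) (auto simp: mixed_def)
  moreover show "card (insert z B) = card B + 1"
    using z(1) disjoint finite(2) by (subst card_insert_disjoint) auto
  ultimately show "insert z B \<in> {S. dominating H S \<and> card S = card B + 1}" by simp
  fix F S assume F: "autonomously_dominating_family H F" "S \<in> F"
  obtain b where b: "b \<in> B" using B_nonempty by blast
  have "card {z, b} \<le> card S"
    using z b arc_cross autonomous_imp_eternal[OF F(1)] F(2)
    by (intro eternal_independent_bound[OF pair_graph_H]) (auto simp: arc_clique)
  moreover have "z \<noteq> b" using z(1) b disjoint by blast
  ultimately have "2 \<le> card S" by simp
  show "card B + 1 \<le> card S"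
  proof (rule ccontr)
    assume "\<not> card B + 1 \<le> card S"
    then obtain T where "T \<subseteq> A" "card T = card S"
      "\<forall>b\<in>B. \<exists>!t. t \<in> T \<and> R t b" "\<forall>t\<in>T. \<exists>b\<in>B. R t b"
      using assms[of "card S"] \<open>2 \<le> card S\<close> by auto
    then show False
      using autonomous_card_neq[OF F, of T] \<open>2 \<le> card S\<close> by simp
  qed
qed

end

section \<open>Realizing the triples\<close>

definition realizable :: "nat \<Rightarrow> nat \<Rightarrow> nat \<Rightarrow> bool" where
  "realizable a b c \<longleftrightarrow> (\<exists>G :: nat pair_pre_digraph. pair_graph G \<and>
     domination_number G = a \<and> eternal_domination_number G = b \<and>
     autonomous_domination_number G = c)"

lemma realizable_shift:
  assumes "realizable a b c"
  shows "realizable (a + k) (b + k) (c + k)"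
proof (induction k)
  case (Suc k)
  then obtain G :: "nat pair_pre_digraph" where G: "pair_graph G" "domination_number G = a + k"
    "eternal_domination_number G = b + k" "autonomous_domination_number G = c + k"
    by (auto simp: realizable_def)
  interpret pair_graph G by (fact G(1))
  obtain w where w: "w \<notin> pverts G"
    using ex_new_if_finite[OF infinite_UNIV_nat pair_finite_verts] by blast
  then show ?case
    using G(2-4) pair_graph_add_isolated[OF G(1) w] domination_number_add_isolated[OF G(1) w]
      eternal_domination_number_add_isolated[OF G(1) w]
      autonomous_domination_number_add_isolated[OF G(1) w]
    unfolding realizable_def by (intro exI[of _ "add_isolated w G"]) simp
qed (use assms in simp)

text \<open>The empty graph, with the empty position as its only one, is the base from which one
  isolated vertex yields (1, 1, 1).\<close>

lemma realizable_0: "realizable 0 0 0"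
proof -
  let ?G = "graph_of {} (\<lambda>_ _. False) :: nat pair_pre_digraph"
  have dom: "dominating ?G S \<longleftrightarrow> S = {}" for S
    by (auto simp: dominating_def)
  have "\<not> adjacent_sets ?G {} S" for S
    by (auto simp: adjacent_sets_def)
  then have aut: "autonomously_dominating_family ?G {{}}"
    using dom by (auto simp: autonomously_dominating_family_def)
  have "domination_number ?G = 0"
    by (rule domination_number_eqI[of _ "{}"]) (simp_all add: dom)
  moreover have "eternal_domination_number ?G = 0"
    by (rule eternal_domination_number_eqI[OF autonomous_imp_eternal[OF aut], of "{}"]) simp_all
  moreover have "autonomous_domination_number ?G = 0"
    by (rule autonomous_domination_number_eqI[OF aut, of "{}"]) simp_all
  ultimately show ?thesis
    unfolding realizable_def by (intro exI[of _ ?G]) (simp add: pair_graph_graph_of)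
qed

lemma realizable_hub:
  assumes "3 \<le> b" and "b \<le> c"
  shows "realizable 1 b c"
proof -
  \<comment> \<open>\<open>m\<close> is the size of \<open>D\<close>. The second interval has
    \<open>b - 2\<close> elements, so \<open>3 \<le> b\<close> makes the set of leaves
    nonempty.\<close>
  define m where "m = c - b + 1"
  interpret hub 0 1 2 "{3..<3 + m}" "{3 + m..<1 + b + m}"
    by unfold_locales (use assms in \<open>auto simp: m_def\<close>)
  have "eternal_domination_number H = b"
    unfolding eternal_domination_number_H using assms by simp
  moreover have "autonomous_domination_number H = c"
    unfolding autonomous_domination_number_H using assms by (simp add: m_def)
  ultimately show ?thesis
    unfolding realizable_def using pair_graph_H domination_number_H
    by (intro exI[of _ H]) simp
qed

text \<open>The first \<open>k - 1\<close> blocks are singletons and the last one takes everything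
  from \<open>k - 1\<close> on. Knowing that \<open>i\<close> lies in block \<open>i\<close> gives
  nonemptiness and tells blocks apart.\<close>

lemma partition_into_k:
  fixes n k :: nat
  assumes "k \<le> n" and "0 < k"
  obtains P where "\<And>i. i < k \<Longrightarrow> P i \<subseteq> {..<n}" and "\<And>i. i < k \<Longrightarrow> i \<in> P i"
    and "disjoint_family_on P {..<k}" and "(\<Union>i<k. P i) = {..<n}"
proof
  show "disjoint_family_on (\<lambda>i. {j. j < n \<and> min j (k - 1) = i}) {..<k}"
    by (auto simp: disjoint_family_on_def)
qed (use assms in auto)

lemma realizable_two_cliques:
  assumes "2 \<le> c" and "a \<in> {1, 2}"
  shows "realizable a 2 c"
proof -
  define n where "n = c - 1"
  then have n: "0 < n" using assms by simp
  \<comment> \<open>The full set is a universal vertex: it is kept for domination number one and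
    dropped for two.\<close>
  define \<A> where "\<A> = (if a = 1 then Pow {..<n} else Pow {..<n} - {{..<n}})"
  \<comment> \<open>The offset \<open>n\<close> keeps the codes disjoint from the clique
    \<open>{..<n}\<close>.\<close>
  define enc where "enc X = n + set_encode X" for X
  define R where "R a b \<longleftrightarrow> b \<in> set_decode (a - n)" for a b :: nat
  have fin: "finite X" if "X \<in> \<A>" for X
    using that finite_subset[of X "{..<n}"] by (auto simp: \<A>_def split: if_splits)
  have R: "R (enc X) b \<longleftrightarrow> b \<in> X" if "X \<in> \<A>" for X b
    using fin[OF that] by (simp add: R_def enc_def)
  have empty: "{} \<in> \<A>" using n by (auto simp: \<A>_def)
  interpret two_cliques "enc ` \<A>" "{..<n}" R "enc {}"
  proof
    show "finite (enc ` \<A>)" by (simp add: \<A>_def)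
    show "enc ` \<A> \<inter> {..<n} = {}" by (auto simp: enc_def)
  qed (use n empty R in auto)
  have "domination_number H = a"
  proof (cases "a = 1")
    case True
    then have "{..<n} \<in> \<A>" by (simp add: \<A>_def)
    with R True show ?thesis
      using domination_number_one[of "enc {..<n}"] by simp
  next
    case False
    have "\<exists>b\<in>{..<n}. \<not> R t b" if t: "t \<in> enc ` \<A>" for t
    proof -
      obtain X where X: "X \<in> \<A>" "t = enc X" using t by blast
      then have "X \<subset> {..<n}" using False by (auto simp: \<A>_def)
      with R X show ?thesis by blast
    qed
    then show ?thesis using domination_number_two False assms(2) by auto
  qed
  moreover have "autonomous_domination_number H = card {..<n} + 1"
  proof (rule autonomous_domination_number_H)
    fix k assume k: "2 \<le> k" "k \<le> card {..<n}"
    then obtain P where P: "\<And>i. i < k \<Longrightarrow> P i \<subseteq> {..<n}" "\<And>i. i < k \<Longrightarrow> i \<in> P i"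
      "disjoint_family_on P {..<k}" "(\<Union>i<k. P i) = {..<n}"
      using partition_into_k[of k n] by auto
    have unique: "i = j" if "x \<in> P i" "x \<in> P j" "i < k" "j < k" for x i j
      using P(3) that by (auto simp: disjoint_family_on_def)
    \<comment> \<open>As \<open>2 \<le> k\<close>, no block is everything, so all blocks are
      vertices even when the full set has been dropped.\<close>
    have "P i \<noteq> {..<n}" if "i < k" for i
    proof
      assume *: "P i = {..<n}"
      define j :: nat where "j = (if i = 0 then 1 else 0)"
      then have j: "j < k" "j \<noteq> i" using k by auto
      then have "j \<in> P i" using * k by auto
      then show False using unique[of j i j] P(2) j that by blast
    qed
    then have mem: "P i \<in> \<A>" if "i < k" for i
      using P(1) that by (auto simp: \<A>_def)
    have "inj_on (enc \<circ> P) {..<k}"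
    proof (rule inj_onI)
      fix i j assume ij: "i \<in> {..<k}" "j \<in> {..<k}" "(enc \<circ> P) i = (enc \<circ> P) j"
      then have "R (enc (P j)) i" using R[OF mem[of i]] P(2)[of i] by auto
      then have "i \<in> P j" using R[OF mem[of j]] ij by simp
      then show "i = j" using unique[of i i j] P(2)[of i] ij by simp
    qed
    then have "card ((enc \<circ> P) ` {..<k}) = k"
      by (subst card_image) simp_all
    moreover have "\<exists>!t. t \<in> (enc \<circ> P) ` {..<k} \<and> R t b" if b: "b \<in> {..<n}" for b
    proof -
      obtain i where i: "i < k" "b \<in> P i" using b P(4) by blast
      show ?thesis
      proof (rule ex1I[of _ "enc (P i)"])
        show "enc (P i) \<in> (enc \<circ> P) ` {..<k} \<and> R (enc (P i)) b"
          using i R mem by auto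
        fix t assume "t \<in> (enc \<circ> P) ` {..<k} \<and> R t b"
        then obtain j where "j < k" "t = enc (P j)" "b \<in> P j" using R mem by auto
        with unique i show "t = enc (P i)" by blast
      qed
    qed
    moreover have "\<exists>b\<in>{..<n}. R t b" if "t \<in> (enc \<circ> P) ` {..<k}" for t
      using that P(1,2) R mem by fastforce
    ultimately show "\<exists>T. T \<subseteq> enc ` \<A> \<and> card T = k \<and>
        (\<forall>b\<in>{..<n}. \<exists>!t. t \<in> T \<and> R t b) \<and> (\<forall>t\<in>T. \<exists>b\<in>{..<n}. R t b)"
      using mem by (intro exI[of _ "(enc \<circ> P) ` {..<k}"]) auto
  qed
  moreover have "card {..<n} + 1 = c" using assms(1) by (simp add: n_def)
  ultimately show ?thesis
    unfolding realizable_def using pair_graph_H eternal_domination_number_H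
    by (intro exI[of _ H]) simp
qed

theorem mainTheorem1:
  fixes a b c :: nat
  assumes "0 < a" and "a \<le> b" and "b \<le> c"
    and "c = 1 \<or> 1 < b"
  shows "\<exists>G :: nat pair_pre_digraph. pair_graph G \<and>
           domination_number G = a \<and>
           eternal_domination_number G = b \<and>
           autonomous_domination_number G = c"
proof -
  \<comment> \<open>The cases follow \<open>b - a\<close>. The first leaves only (1, 1, 1); the
    others remove isolated vertices down to (2, 2, c - b + 2), (1, 2, c - a + 1) and (1, b - a + 1,
    c - a + 1), the last with middle entry at least three.\<close>
  consider "b = 1" | "1 < b" "a = b" | "b = a + 1" | "a + 2 \<le> b"
    using assms by linarith
  then have "realizable a b c"
  proof cases
    case 1
    with assms have "a = 1" "c = 1" by auto
    with 1 show ?thesis using realizable_shift[OF realizable_0, of 1] by simp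
  next
    case 2
    have "realizable 2 2 (c - b + 2)" by (rule realizable_two_cliques) simp_all
    then have "realizable (2 + (b - 2)) (2 + (b - 2)) (c - b + 2 + (b - 2))"
      by (rule realizable_shift)
    moreover have "2 + (b - 2) = b" "c - b + 2 + (b - 2) = c" using assms 2 by auto
    ultimately show ?thesis using 2(2) by metis
  next
    case 3
    then show ?thesis
      using assms realizable_shift[OF realizable_two_cliques[of "c - a + 1" 1], of "a - 1"] by simp
  next
    case 4
    then show ?thesis
      using assms realizable_shift[OF realizable_hub[of "b - a + 1" "c - a + 1"], of "a - 1"] by simp
  qed
  then show ?thesis by (simp add: realizable_def)
qed

end
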